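(* Let $\lambda>0$ and, under the DRO assumptions on $\ell$ and $\psi^*$ listed in the context, define on $\mathbb{R}^{n+1}$ $$\mathcal L(x,\eta):=\mathbb{E}_{\xi\sim P}[\mathcal L(x,\eta;\xi)],\qquad \mathcal L(x,\eta;\xi):=\lambda\,\psi^*\!\left(\frac{\ell(x;\xi)-\eta}{\lambda}\right)+\eta .$$ Then $F:=\mathcal L$, viewed as a function of $z=(x,\eta)\in\mathbb{R}^{n+1}$ with stochastic components $f(z;\xi):=\mathcal L(x,\eta;\xi)$, satisfies the following three conditions for suitable constants: (1) ($(L_0,L_1)$-smoothness) there are $L_0>0,L_1\ge0$ such that $\|z-z'\|\le 1/L_1$ implies $\|\nabla F(z)-\nabla F(z')\|\le(L_0+L_1\|\nabla F(z)\|)\|z-z'\|$; (2) (gradient variance) there are $G_0,G_1\geq 0$ such that $\mathbb{E}_\xi[\nabla f(z;\xi)]=\nabla F(z)$ and $\mathbb{E}_\xi\|\nabla f(z;\xi)-\nabla F(z)\|^2\le G_0^2+G_1^2\|\nabla F(z)\|^2$ for all $z$; (3) (second-order generalized smoothness and Hessian variance) $F$ is twice differentiable; there are $\delta>0$, $M_0>0$, $M_1\ge0$ such that $\|z-z'\|\le\delta$ implies $\|\nabla^2F(z)-\nabla^2F(z')\|\le(M_0+M_1\|\nabla F(z)\|)\|z-z'\|$; and there are $K_0,K_1\ge0$ such that $\mathbb{E}_\xi[\nabla^2 f(z;\xi)]=\nabla^2F(z)$ and $\mathbb{E}_\xi\|\nabla^2f(z;\xi)-\nabla^2F(z)\|^2\le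 K_0^2+K_1^2\|\nabla F(z)\|^2$ for all $z$.
   Context: Norms are Euclidean for vectors and spectral for matrices. $\psi$ is a valid divergence function: $\psi\ge0$, $\psi(1)=0$, $\psi(t)=+\infty$ for $t<0$; its conjugate is $\psi^*(t):=\sup_{s\in\mathbb{R}}(st-\psi(s))$. DRO assumptions: (i) For every $\xi$ in its support, $\ell(\cdot;\xi)$ is twice differentiable on $\mathbb{R}^n$ and for all $x,x'$: $|\ell(x;\xi)-\ell(x';\xi)|\le G\|x-x'\|$, $\|\nabla\ell(x;\xi)-\nabla\ell(x';\xi)\|\le L\|x-x'\|$, $\|\nabla^2\ell(x;\xi)-\nabla^2\ell(x';\xi)\|\le M\|x-x'\|$. (ii) $\psi^*$ is (finite and) strictly convex, twice continuously differentiable on $\mathbb{R}$, with $|(\psi^* )'(s)-(\psi^* )'(s')|\le N_1|s-s'|$ and $|(\psi^* )''(s)-(\psi^* )''(s')|\le N_2|s-s'|$. (iii) For all $x$, $\mathbb{E}_{\xi\sim P}[(\ell(x;\xi)-\ell(x))^2]\le\sigma^2$, where $\ell(x)=\mathbb{E}_{\xi\sim P}[\ell(x;\xi)]$; moreover there are constants $m,\bar M$ with $m\le\ell(x;\xi)\le\bar M$ for all $x$ and $\xi\sim P$. (iv) There is $\delta_0>0$ such that $\inf\{t:(\psi^* )'(t)\ge1-\delta_0\}>-\infty$ and $\sup\{t:(\psi^* )'(t)\le1+\delta_0\}<+\infty$. *)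

theory Defs
  imports "HOL-Probability.Probability"
begin

text \<open>The Bochner integral needs a second countable codomain; the library provides this for
  spaces of bounded linear maps only in the form of the Heine-Borel property.\<close>

instance blinfun :: (euclidean_space, euclidean_space) second_countable_topology
proof
  have "\<exists>D. finite D \<and> cball (0 :: 'a \<Rightarrow>\<^sub>L 'b) (real n) \<subseteq> (\<Union>x\<in>D. ball x (1 / real (Suc k)))" for n k
  proof -
    have "compact (cball (0 :: 'a \<Rightarrow>\<^sub>L 'b) (real n))"
      by (rule compact_cball)
    then have "\<forall>e>0. \<exists>D. finite D \<and> cball (0 :: 'a \<Rightarrow>\<^sub>L 'b) (real n) \<subseteq> (\<Union>x\<in>D. ball x e)"
      by (simp add: compact_eq_totally_bounded)
    then show ?thesis
      by (rule allE[where x = "1 / real (Suc k)"]) simp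
  qed
  then have "\<exists>D. \<forall>n k. finite (D n k) \<and>
      cball (0 :: 'a \<Rightarrow>\<^sub>L 'b) (real n) \<subseteq> (\<Union>x\<in>D n k. ball x (1 / real (Suc k)))"
    by (intro choice allI)
  then obtain D where D: "\<And>n k. finite (D n k)"
    "\<And>n k. cball (0 :: 'a \<Rightarrow>\<^sub>L 'b) (real n) \<subseteq> (\<Union>x\<in>D n k. ball x (1 / real (Suc k)))"
    by blast
  define B where "B = (\<Union>n k. (\<lambda>x. ball x (1 / real (Suc k))) ` D n k)"
  have cB: "countable B"
    unfolding B_def by (intro countable_UN countableI_type countable_image countable_finite[OF D(1)])
  have oB: "open b" if "b \<in> B" for b
    using that unfolding B_def by auto
  have near: "\<exists>b\<in>B. x \<in> b \<and> b \<subseteq> S" if S: "open S" "x \<in> S" for S and x :: "'a \<Rightarrow>\<^sub>L 'b"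
  proof -
    obtain e where e: "e > 0" "ball x e \<subseteq> S"
      using S by (meson openE)
    obtain k where k: "1 / real (Suc k) < e / 2"
      using e(1) nat_approx_posE[of "e / 2"] by auto
    obtain n where n: "norm x \<le> real n"
      using real_arch_simple by blast
    then have "x \<in> cball 0 (real n)"
      by simp
    then obtain y where y: "y \<in> D n k" "x \<in> ball y (1 / real (Suc k))"
      using D(2)[of n k] by blast
    have "ball y (1 / real (Suc k)) \<subseteq> ball x e"
    proof
      fix w assume "w \<in> ball y (1 / real (Suc k))"
      then show "w \<in> ball x e"
        using y(2) k dist_triangle[of x w y] dist_commute[of x y] dist_commute[of w y]
        unfolding mem_ball by linarith
    qed
    moreover have "ball y (1 / real (Suc k)) \<in> B"
      using y(1) unfolding B_def by blast
    ultimately show ?thesis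
      using e(2) by (intro bexI[of _ "ball y (1 / real (Suc k))"] conjI) (rule y(2), rule subset_trans, assumption+)
  qed
  have "topological_basis B"
    by (rule topological_basisI) (erule oB, erule (1) near)
  then have "open = generate_topology B"
    by (rule topological_basis_imp_subbasis)
  with cB show "\<exists>B::('a \<Rightarrow>\<^sub>L 'b) set set. countable B \<and> open = generate_topology B"
    by blast
qed

definition strictly_convex_on :: "real set \<Rightarrow> (real \<Rightarrow> real) \<Rightarrow> bool" where
  "strictly_convex_on S g \<longleftrightarrow> convex S \<and>
    (\<forall>s\<in>S. \<forall>t\<in>S. \<forall>u. s \<noteq> t \<and> 0 < u \<and> u < 1 \<longrightarrow>
       g ((1 - u) * s + u * t) < (1 - u) * g s + u * g t)"

definition valid_divergence :: "(real \<Rightarrow> ereal) \<Rightarrow> bool" where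
  "valid_divergence \<psi> \<longleftrightarrow> (\<forall>t. 0 \<le> \<psi> t) \<and> \<psi> 1 = 0 \<and> (\<forall>t<0. \<psi> t = \<infinity>)"

definition conjugate :: "(real \<Rightarrow> ereal) \<Rightarrow> real \<Rightarrow> ereal" where
  "conjugate \<psi> t = (SUP s. ereal (s * t) - \<psi> s)"

text \<open>Meaningful only where the conjugate is finite.\<close>
definition rconjugate :: "(real \<Rightarrow> ereal) \<Rightarrow> real \<Rightarrow> real" where
  "rconjugate \<psi> t = real_of_ereal (conjugate \<psi> t)"

text \<open>The gradient and the Hessian are unspecified at points where the function is not
  (twice) differentiable. The Hessian is a bounded linear map, so its norm is the spectral norm.\<close>

definition grad :: "('a::euclidean_space \<Rightarrow> real) \<Rightarrow> 'a \<Rightarrow> 'a" where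
  "grad f x = (THE D. GDERIV f x :> D)"

definition hess :: "('a::euclidean_space \<Rightarrow> real) \<Rightarrow> 'a \<Rightarrow> 'a \<Rightarrow>\<^sub>L 'a" where
  "hess f x = (THE H. (grad f has_derivative blinfun_apply H) (at x))"

definition twice_differentiable :: "('a::euclidean_space \<Rightarrow> real) \<Rightarrow> bool" where
  "twice_differentiable f \<longleftrightarrow>
     (\<forall>x. f differentiable (at x)) \<and> (\<forall>x. grad f differentiable (at x))"

definition dro_loss ::
  "(real \<Rightarrow> ereal) \<Rightarrow> real \<Rightarrow> ('a \<Rightarrow> 'x \<Rightarrow> real) \<Rightarrow> 'x \<Rightarrow> 'a \<times> real \<Rightarrow> real" where
  "dro_loss \<psi> lam l \<xi> = (\<lambda>(x, \<eta>). lam * rconjugate \<psi> ((l x \<xi> - \<eta>) / lam) + \<eta>)"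

definition dro_objective ::
  "(real \<Rightarrow> ereal) \<Rightarrow> real \<Rightarrow> ('a \<Rightarrow> 'x \<Rightarrow> real) \<Rightarrow> 'x measure \<Rightarrow> 'a \<times> real \<Rightarrow> real" where
  "dro_objective \<psi> lam l P z = (\<integral>\<xi>. dro_loss \<psi> lam l \<xi> z \<partial>P)"

text \<open>In the next definition the radius \<open>1 / L\<^sub>1\<close> means \<open>\<infinity>\<close> if \<open>L\<^sub>1 = 0\<close>, whereas \<open>1 / 0 = 0\<close>
  in HOL; hence the disjunction.\<close>

definition gen_smooth :: "('a::euclidean_space \<Rightarrow> real) \<Rightarrow> real \<Rightarrow> real \<Rightarrow> bool" where
  "gen_smooth F L\<^sub>0 L\<^sub>1 \<longleftrightarrow>
     (\<forall>z. F differentiable (at z)) \<and>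
     (\<forall>z z'. L\<^sub>1 = 0 \<or> norm (z - z') \<le> 1 / L\<^sub>1 \<longrightarrow>
        norm (grad F z - grad F z') \<le> (L\<^sub>0 + L\<^sub>1 * norm (grad F z)) * norm (z - z'))"

text \<open>Integrability is stated explicitly below because a divergent Bochner integral is \<open>0\<close>.\<close>

definition gen_grad_variance ::
  "('a::euclidean_space \<Rightarrow> real) \<Rightarrow> ('x \<Rightarrow> 'a \<Rightarrow> real) \<Rightarrow> 'x measure \<Rightarrow> real \<Rightarrow> real \<Rightarrow> bool" where
  "gen_grad_variance F f P G\<^sub>0 G\<^sub>1 \<longleftrightarrow>
     (\<forall>\<xi>\<in>space P. \<forall>z. f \<xi> differentiable (at z)) \<and>
     (\<forall>z. integrable P (\<lambda>\<xi>. grad (f \<xi>) z) \<and>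
          (\<integral>\<xi>. grad (f \<xi>) z \<partial>P) = grad F z \<and>
          integrable P (\<lambda>\<xi>. (norm (grad (f \<xi>) z - grad F z))\<^sup>2) \<and>
          (\<integral>\<xi>. (norm (grad (f \<xi>) z - grad F z))\<^sup>2 \<partial>P)
             \<le> G\<^sub>0\<^sup>2 + G\<^sub>1\<^sup>2 * (norm (grad F z))\<^sup>2)"

definition gen_hess_smooth :: "('a::euclidean_space \<Rightarrow> real) \<Rightarrow> real \<Rightarrow> real \<Rightarrow> real \<Rightarrow> bool" where
  "gen_hess_smooth F \<delta> M\<^sub>0 M\<^sub>1 \<longleftrightarrow>
     (\<forall>z z'. norm (z - z') \<le> \<delta> \<longrightarrow>
        norm (hess F z - hess F z') \<le> (M\<^sub>0 + M\<^sub>1 * norm (grad F z)) * norm (z - z'))"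

definition gen_hess_variance ::
  "('a::euclidean_space \<Rightarrow> real) \<Rightarrow> ('x \<Rightarrow> 'a \<Rightarrow> real) \<Rightarrow> 'x measure \<Rightarrow> real \<Rightarrow> real \<Rightarrow> bool" where
  "gen_hess_variance F f P K\<^sub>0 K\<^sub>1 \<longleftrightarrow>
     (\<forall>\<xi>\<in>space P. twice_differentiable (f \<xi>)) \<and>
     (\<forall>z. integrable P (\<lambda>\<xi>. hess (f \<xi>) z) \<and>
          (\<integral>\<xi>. hess (f \<xi>) z \<partial>P) = hess F z \<and>
          integrable P (\<lambda>\<xi>. (norm (hess (f \<xi>) z - hess F z))\<^sup>2) \<and>
          (\<integral>\<xi>. (norm (hess (f \<xi>) z - hess F z))\<^sup>2 \<partial>P)
             \<le> K\<^sub>0\<^sup>2 + K\<^sub>1\<^sup>2 * (norm (grad F z))\<^sup>2)"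

end

theory Submission
  imports Defs
begin

text \<open>With \<open>p = (\<psi>\<^sup>*)'\<close> and \<open>u = (l x \<xi> - \<eta>) / \<lambda>\<close>, the gradient of the loss is
  \<open>(p u \<cdot> \<nabla>l, 1 - p u)\<close>. The norms of its gradient and Hessian, and the Lipschitz constants of both
  at a point, are all bounded by \<open>\<alpha> + \<beta> \<bar>p u\<bar>\<close>. As \<open>l\<close> is bounded and \<open>p\<close> is Lipschitz, \<open>p u\<close> almost
  surely varies with \<open>\<xi>\<close> only within an interval of fixed length, while its mean is \<open>1 - \<partial>F/\<partial>\<eta>\<close>; hence
  \<open>\<bar>p u\<bar>\<close> is almost surely at most a constant plus \<open>\<parallel>\<nabla>F\<parallel>\<close>, and the estimates survive integration.
  The quadratic remainder that comes with these Lipschitz bounds also justifies differentiation under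
  the integral, without dominated convergence.\<close>

subsection \<open>Gradients and Hessians\<close>

text \<open>The derivative is reached along a single sequence, so that both bounds and measurability
  pass from difference quotients to it. \<open>Suc n\<close> keeps the step
  \<open>1 / real (Suc n)\<close> nonzero.\<close>

lemma difference_quotient_LIMSEQ:
  fixes f :: "'a::real_normed_vector \<Rightarrow> 'b::real_normed_vector"
  assumes "(f has_derivative f') (at x)"
  shows "(\<lambda>n. real (Suc n) *\<^sub>R (f (x + (1 / real (Suc n)) *\<^sub>R a) - f x)) \<longlonglongrightarrow> f' a"
proof -
  interpret f': bounded_linear f'
    using assms by (rule has_derivative_bounded_linear)
  have "((\<lambda>t. f (x + t *\<^sub>R a)) has_derivative (\<lambda>t. f' (t *\<^sub>R a))) (at 0)"
    by (rule has_derivative_compose[where f = "\<lambda>t. x + t *\<^sub>R a" and g = f])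
       (auto intro!: derivative_eq_intros simp: assms)
  then have "((\<lambda>t. norm (f (x + t *\<^sub>R a) - f x - f' (t *\<^sub>R a)) / norm t) \<longlongrightarrow> 0) (at 0)"
    by (simp add: has_derivative_at)
  moreover have "norm (f (x + t *\<^sub>R a) - f x - f' (t *\<^sub>R a)) / norm t
      = norm ((f (x + t *\<^sub>R a) - f x) /\<^sub>R t - f' a)" if "t \<noteq> 0" for t
  proof -
    have "(f (x + t *\<^sub>R a) - f x) /\<^sub>R t - f' a = (f (x + t *\<^sub>R a) - f x - f' (t *\<^sub>R a)) /\<^sub>R t"
      using that by (simp add: f'.scaleR scaleR_diff_right)
    then show ?thesis
      by (simp add: divide_inverse mult.commute)
  qed
  ultimately have "((\<lambda>t. norm ((f (x + t *\<^sub>R a) - f x) /\<^sub>R t - f' a)) \<longlongrightarrow> 0) (at 0)"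
    by (simp cong: LIM_cong)
  then have lim: "((\<lambda>t. (f (x + t *\<^sub>R a) - f x) /\<^sub>R t) \<longlongrightarrow> f' a) (at 0)"
    by (simp add: tendsto_norm_zero_iff LIM_zero_iff)
  have "filterlim (\<lambda>n. 1 / real (Suc n)) (at 0) sequentially"
    by (rule filterlim_atI) (use LIMSEQ_inverse_real_of_nat in \<open>auto simp: inverse_eq_divide\<close>)
  from filterlim_compose[OF lim this] show ?thesis
    by simp
qed

text \<open>Every difference quotient obeys the bound, which survives the limit. The Lipschitz
  condition is anchored at the single point \<open>x\<close>, so \<open>B\<close> may depend on
  \<open>x\<close>; this matters where \<open>B\<close> involves the slope at that point.\<close>

lemma derivative_bound_of_lipschitz:
  fixes f :: "'a::real_normed_vector \<Rightarrow> 'b::real_normed_vector"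
  assumes "(f has_derivative f') (at x)"
    and lip: "\<And>y. norm (f y - f x) \<le> B * norm (y - x)"
  shows "norm (f' a) \<le> B * norm a"
proof (rule LIMSEQ_le_const2)
  show "(\<lambda>n. norm (real (Suc n) *\<^sub>R (f (x + (1 / real (Suc n)) *\<^sub>R a) - f x))) \<longlonglongrightarrow> norm (f' a)"
    by (intro tendsto_norm difference_quotient_LIMSEQ assms)
  have "norm (real (Suc n) *\<^sub>R (f (x + (1 / real (Suc n)) *\<^sub>R a) - f x)) \<le> B * norm a" for n
  proof -
    have "real (Suc n) * norm (f (x + (1 / real (Suc n)) *\<^sub>R a) - f x)
        \<le> real (Suc n) * (B * norm ((1 / real (Suc n)) *\<^sub>R a))"
      using lip[of "x + (1 / real (Suc n)) *\<^sub>R a"] by (intro mult_left_mono) simp_all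
    then show ?thesis
      by simp
  qed
  then show "\<exists>N. \<forall>n\<ge>N. norm (real (Suc n) *\<^sub>R (f (x + (1 / real (Suc n)) *\<^sub>R a) - f x)) \<le> B * norm a"
    by blast
qed

text \<open>\<open>grad\<close> is a definite description, so its value rests on uniqueness: the
  derivative is unique, and the inner product determines the vector that represents it.\<close>

lemma grad_eqI:
  assumes "GDERIV f x :> D"
  shows "grad f x = D"
  unfolding grad_def
proof (rule the_equality)
  fix D' assume "GDERIV f x :> D'"
  with assms have "(\<lambda>h. h \<bullet> D') = (\<lambda>h. h \<bullet> D)"
    unfolding gderiv_def by (metis has_derivative_unique)
  then show "D' = D"
    by (metis (no_types) vector_eq_rdot inner_commute)
qed (rule assms)

text \<open>Riesz representation in coordinates: the derivative is the inner product with the vector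
  of its values on \<open>Basis\<close>.\<close>

lemma GDERIV_grad:
  assumes "f differentiable (at x)"
  shows "GDERIV f x :> grad f x"
proof -
  obtain f' where f': "(f has_derivative f') (at x)"
    using assms unfolding differentiable_def by blast
  interpret f': bounded_linear f'
    using f' by (rule has_derivative_bounded_linear)
  have "f' h = h \<bullet> (\<Sum>b\<in>Basis. f' b *\<^sub>R b)" for h
  proof -
    have "f' h = f' (\<Sum>b\<in>Basis. (h \<bullet> b) *\<^sub>R b)"
      by (simp add: euclidean_representation)
    also have "\<dots> = (\<Sum>b\<in>Basis. (h \<bullet> b) * f' b)"
      by (simp add: f'.sum f'.scaleR)
    finally show ?thesis
      by (simp add: inner_sum_right mult.commute)
  qed
  then have "f' = (\<lambda>h. h \<bullet> (\<Sum>b\<in>Basis. f' b *\<^sub>R b))"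
    by blast
  with f' have "GDERIV f x :> (\<Sum>b\<in>Basis. f' b *\<^sub>R b)"
    unfolding gderiv_def by metis
  then show ?thesis
    using grad_eqI by metis
qed

lemma hess_eqI:
  assumes "(grad f has_derivative blinfun_apply H) (at x)"
  shows "hess f x = H"
  unfolding hess_def
proof (rule the_equality)
  fix H' assume "(grad f has_derivative blinfun_apply H') (at x)"
  with assms show "H' = H"
    by (metis has_derivative_unique blinfun_eqI)
qed (rule assms)

lemma has_derivative_hess:
  assumes "grad f differentiable (at x)"
  shows "(grad f has_derivative blinfun_apply (hess f x)) (at x)"
proof -
  obtain f' where f': "(grad f has_derivative f') (at x)"
    using assms unfolding differentiable_def by blast
  then have "(grad f has_derivative blinfun_apply (Blinfun f')) (at x)"
    by (simp add: bounded_linear_Blinfun_apply[OF has_derivative_bounded_linear])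
  then show ?thesis
    using hess_eqI by metis
qed

lemma norm_grad_le:
  assumes "f differentiable (at x)" "0 \<le> B" "\<And>y. \<bar>f y - f x\<bar> \<le> B * norm (y - x)"
  shows "norm (grad f x) \<le> B"
proof -
  \<comment> \<open>Testing the derivative in the direction of the gradient itself puts the squared
    norm on the left; one factor is then cancelled.\<close>
  have "norm (grad f x \<bullet> grad f x) \<le> B * norm (grad f x)"
    using derivative_bound_of_lipschitz[of f "\<lambda>h. h \<bullet> grad f x" x B "grad f x"]
      GDERIV_grad[OF assms(1)] assms(3) unfolding gderiv_def by simp
  then have "norm (grad f x) * norm (grad f x) \<le> B * norm (grad f x)"
    by (simp add: power2_norm_eq_inner[symmetric] power2_eq_square)
  then show ?thesis
    using assms(2) by (cases "grad f x = 0") auto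
qed

lemma norm_hess_le:
  assumes "grad f differentiable (at x)" "0 \<le> B"
    and "\<And>y. norm (grad f y - grad f x) \<le> B * norm (y - x)"
  shows "norm (hess f x) \<le> B"
  using assms(2) derivative_bound_of_lipschitz[OF has_derivative_hess[OF assms(1)] assms(3)]
  by (rule norm_blinfun_bound)

subsection \<open>Measurability and differentiation under the integral\<close>

text \<open>The operators \<open>E i j\<close> are the matrix units, so \<open>X\<close> is a finite
  combination of fixed operators whose coefficients are its measurable matrix entries.\<close>

lemma borel_measurable_blinfunI:
  fixes X :: "'x \<Rightarrow> 'a::euclidean_space \<Rightarrow>\<^sub>L 'b::euclidean_space"
  assumes "\<And>i j. i \<in> Basis \<Longrightarrow> j \<in> Basis \<Longrightarrow> (\<lambda>\<omega>. X \<omega> i \<bullet> j) \<in> borel_measurable P"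
  shows "X \<in> borel_measurable P"
proof -
  define E :: "'a \<Rightarrow> 'b \<Rightarrow> 'a \<Rightarrow>\<^sub>L 'b" where "E i j = Blinfun (\<lambda>v. (v \<bullet> i) *\<^sub>R j)" for i j
  have E: "blinfun_apply (E i j) v = (v \<bullet> i) *\<^sub>R j" for i j v
    unfolding E_def
    by (subst bounded_linear_Blinfun_apply)
       (auto intro!: bounded_linear_intros)
  have "X \<omega> = (\<Sum>i\<in>Basis. \<Sum>j\<in>Basis. (X \<omega> i \<bullet> j) *\<^sub>R E i j)" for \<omega>
  proof (rule blinfun_euclidean_eqI)
    fix k :: 'a assume k: "k \<in> Basis"
    have "blinfun_apply (\<Sum>i\<in>Basis. \<Sum>j\<in>Basis. (X \<omega> i \<bullet> j) *\<^sub>R E i j) k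
        = (\<Sum>i\<in>Basis. (k \<bullet> i) *\<^sub>R (\<Sum>j\<in>Basis. (X \<omega> i \<bullet> j) *\<^sub>R j))"
      by (simp add: blinfun.sum_left blinfun.scaleR_left E scaleR_sum_right mult.commute)
    also have "\<dots> = (\<Sum>i\<in>Basis. (k \<bullet> i) *\<^sub>R X \<omega> i)"
      by (simp only: euclidean_representation)
    also have "\<dots> = X \<omega> (\<Sum>i\<in>Basis. (k \<bullet> i) *\<^sub>R i)"
      by (simp only: blinfun.sum_right blinfun.scaleR_right)
    also have "\<dots> = X \<omega> k"
      by (simp only: euclidean_representation)
    finally show "X \<omega> k = blinfun_apply (\<Sum>i\<in>Basis. \<Sum>j\<in>Basis. (X \<omega> i \<bullet> j) *\<^sub>R E i j) k" ..
  qed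
  then have "X = (\<lambda>\<omega>. \<Sum>i\<in>Basis. \<Sum>j\<in>Basis. (X \<omega> i \<bullet> j) *\<^sub>R E i j)"
    by blast
  also have "\<dots> \<in> borel_measurable P"
    using assms by measurable
  finally show ?thesis .
qed

text \<open>The derivative is a pointwise limit of a sequence of measurable difference
  quotients.\<close>

lemma borel_measurable_derivative:
  fixes f :: "'x \<Rightarrow> 'a::euclidean_space \<Rightarrow> 'b::euclidean_space"
  assumes "\<And>y. (\<lambda>\<omega>. f \<omega> y) \<in> borel_measurable P"
    and "\<And>\<omega>. \<omega> \<in> space P \<Longrightarrow> (f \<omega> has_derivative f' \<omega>) (at x)"
  shows "(\<lambda>\<omega>. f' \<omega> a) \<in> borel_measurable P"
proof (rule borel_measurable_LIMSEQ_metric)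
  show "(\<lambda>n. real (Suc n) *\<^sub>R (f \<omega> (x + (1 / real (Suc n)) *\<^sub>R a) - f \<omega> x)) \<longlonglongrightarrow> f' \<omega> a"
    if "\<omega> \<in> space P" for \<omega>
    using assms(2)[OF that] by (rule difference_quotient_LIMSEQ)
  show "(\<lambda>\<omega>. real (Suc n) *\<^sub>R (f \<omega> (x + (1 / real (Suc n)) *\<^sub>R a) - f \<omega> x)) \<in> borel_measurable P" for n
    using assms(1) by measurable
qed

lemma borel_measurable_grad:
  fixes f :: "'x \<Rightarrow> 'a::euclidean_space \<Rightarrow> real"
  assumes "\<And>y. (\<lambda>\<omega>. f \<omega> y) \<in> borel_measurable P"
    and "\<And>\<omega>. \<omega> \<in> space P \<Longrightarrow> f \<omega> differentiable (at x)"
  shows "(\<lambda>\<omega>. grad (f \<omega>) x) \<in> borel_measurable P"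
proof -
  \<comment> \<open>The component of the gradient along \<open>i\<close> is the directional
    derivative along \<open>i\<close>.\<close>
  have "(\<lambda>\<omega>. i \<bullet> grad (f \<omega>) x) \<in> borel_measurable P" for i
    by (rule borel_measurable_derivative[where f = f and f' = "\<lambda>\<omega> h. h \<bullet> grad (f \<omega>) x"])
       (use assms GDERIV_grad in \<open>auto simp: gderiv_def\<close>)
  then show ?thesis
    by (subst borel_measurable_euclidean_space) (simp add: inner_commute)
qed

lemma borel_measurable_hess:
  fixes f :: "'x \<Rightarrow> 'a::euclidean_space \<Rightarrow> real"
  assumes "\<And>y. (\<lambda>\<omega>. grad (f \<omega>) y) \<in> borel_measurable P"
    and "\<And>\<omega>. \<omega> \<in> space P \<Longrightarrow> grad (f \<omega>) differentiable (at x)"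
  shows "(\<lambda>\<omega>. hess (f \<omega>) x) \<in> borel_measurable P"
proof (rule borel_measurable_blinfunI)
  fix i j :: 'a
  have "(\<lambda>\<omega>. hess (f \<omega>) x i) \<in> borel_measurable P"
    by (rule borel_measurable_derivative[where f = "\<lambda>\<omega>. grad (f \<omega>)"])
       (use assms has_derivative_hess in auto)
  then show "(\<lambda>\<omega>. hess (f \<omega>) x i \<bullet> j) \<in> borel_measurable P"
    by measurable
qed

lemma (in prob_space) norm_expectation_le:
  fixes X :: "'a \<Rightarrow> 'b::{banach, second_countable_topology}"
  assumes "integrable M X" "AE \<omega> in M. norm (X \<omega>) \<le> c"
  shows "norm (expectation X) \<le> c"
proof -
  have "norm (expectation X) \<le> expectation (\<lambda>\<omega>. norm (X \<omega>))"
    by (rule integral_norm_bound)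
  also have "\<dots> \<le> expectation (\<lambda>\<omega>. c)"
    using assms by (intro integral_mono_AE) auto
  finally show ?thesis
    by (simp add: prob_space)
qed

text \<open>\<open>pair\<close> abstracts how \<open>D\<close> acts on a displacement: by the inner
  product for gradients, by application for Hessians, so one statement serves both orders of
  differentiation. The Lipschitz bound on \<open>D\<close> makes the remainder quadratic in
  \<open>norm (y - x)\<close>, uniformly in \<open>\<omega>\<close>, so it can be integrated. The
  quantifier over \<open>y\<close> lies inside \<open>AE\<close> because, for a fixed
  \<open>\<omega>\<close>, the mean value estimate visits a whole segment.\<close>

lemma (in prob_space) has_derivative_expectation:
  fixes f :: "'a \<Rightarrow> 'b::real_normed_vector \<Rightarrow> 'c::{banach, second_countable_topology}"
    and D :: "'a \<Rightarrow> 'b \<Rightarrow> 'd::{banach, second_countable_topology}"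
  assumes pair: "bounded_bilinear pair" "\<And>d h. norm (pair d h) \<le> norm d * norm h"
    and f: "\<And>y. integrable M (\<lambda>\<omega>. f \<omega> y)"
    and D: "integrable M (\<lambda>\<omega>. D \<omega> x)"
    and deriv: "\<And>\<omega> y. \<omega> \<in> space M \<Longrightarrow> (f \<omega> has_derivative pair (D \<omega> y)) (at y)"
    and lip: "AE \<omega> in M. \<forall>y. norm (D \<omega> y - D \<omega> x) \<le> B * norm (y - x)"
  shows "((\<lambda>y. expectation (\<lambda>\<omega>. f \<omega> y)) has_derivative pair (expectation (\<lambda>\<omega>. D \<omega> x))) (at x)"
proof (rule has_derivativeI_sandwich[where e = 1 and H = "\<lambda>y. \<bar>B\<bar> * norm (y - x)"])
  interpret pair: bounded_bilinear pair
    by (rule pair(1))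
  show "bounded_linear (pair (expectation (\<lambda>\<omega>. D \<omega> x)))"
    by (rule pair.bounded_linear_right)
  show "((\<lambda>y. \<bar>B\<bar> * norm (y - x)) \<longlongrightarrow> 0) (at x)"
    by (auto intro!: tendsto_eq_intros)
  fix y assume "y \<noteq> x"
  have int: "integrable M (\<lambda>\<omega>. pair (D \<omega> x) (y - x))"
    by (rule integrable_bounded_linear[OF pair.bounded_linear_left D])
  have "AE \<omega> in M. norm (f \<omega> y - f \<omega> x - pair (D \<omega> x) (y - x)) \<le> \<bar>B\<bar> * norm (y - x) * norm (y - x)"
    using lip AE_space
  proof eventually_elim
    case (elim \<omega>)
    have "norm (f \<omega> y - f \<omega> x - pair (D \<omega> x) (y - x)) \<le> norm (y - x) * (\<bar>B\<bar> * norm (y - x))"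
    \<comment> \<open>Mean value inequality for \<open>f \<omega>\<close> minus its linearization at
      \<open>x\<close>: along the segment the derivative moves by at most
      \<open>\<bar>B\<bar> * norm (y - x)\<close>. The absolute value appears because
      \<open>B\<close> comes without a sign.\<close>
    proof (rule differentiable_bound_linearization[where f' = "\<lambda>w. pair (D \<omega> w)" and S = "closed_segment x y"])
      fix w assume w: "w \<in> closed_segment x y"
      show "(f \<omega> has_derivative pair (D \<omega> w)) (at w within closed_segment x y)"
        using deriv[OF elim(2)] by (rule has_derivative_at_withinI)
      have "norm (D \<omega> w - D \<omega> x) \<le> B * norm (w - x)"
        using elim(1) by blast
      also have "\<dots> \<le> \<bar>B\<bar> * norm (w - x)"
        by (intro mult_right_mono) auto
      also have "\<dots> \<le> \<bar>B\<bar> * norm (y - x)"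
        using segment_bound(1)[OF w] by (intro mult_left_mono) (auto simp: norm_minus_commute)
      finally have bound: "norm (D \<omega> w - D \<omega> x) \<le> \<bar>B\<bar> * norm (y - x)" .
      show "onorm (pair (D \<omega> w) - pair (D \<omega> x)) \<le> \<bar>B\<bar> * norm (y - x)"
      proof (rule onorm_bound)
        fix h
        have "norm ((pair (D \<omega> w) - pair (D \<omega> x)) h) = norm (pair (D \<omega> w - D \<omega> x) h)"
          by (simp add: pair.diff_left)
        also have "\<dots> \<le> norm (D \<omega> w - D \<omega> x) * norm h"
          by (rule pair(2))
        also have "\<dots> \<le> \<bar>B\<bar> * norm (y - x) * norm h"
          by (intro mult_right_mono bound) simp
        finally show "norm ((pair (D \<omega> w) - pair (D \<omega> x)) h) \<le> \<bar>B\<bar> * norm (y - x) * norm h" .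
      qed simp
    next
      fix t :: real assume "t \<in> {0..1}"
      then show "x + t *\<^sub>R (y - x) \<in> closed_segment x y"
        by (auto simp: in_segment algebra_simps intro!: exI[of _ t])
    qed simp
    then show ?case
      by (simp add: mult_ac)
  qed
  then have "norm (expectation (\<lambda>\<omega>. f \<omega> y - f \<omega> x - pair (D \<omega> x) (y - x))) \<le> \<bar>B\<bar> * norm (y - x) * norm (y - x)"
    using f int by (intro norm_expectation_le) auto
  moreover have "expectation (\<lambda>\<omega>. f \<omega> y - f \<omega> x - pair (D \<omega> x) (y - x))
      = expectation (\<lambda>\<omega>. f \<omega> y) - expectation (\<lambda>\<omega>. f \<omega> x) - pair (expectation (\<lambda>\<omega>. D \<omega> x)) (y - x)"
    using f int by (simp add: integral_bounded_linear[OF pair.bounded_linear_left D])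
  ultimately show "norm (expectation (\<lambda>\<omega>. f \<omega> y) - expectation (\<lambda>\<omega>. f \<omega> x) - pair (expectation (\<lambda>\<omega>. D \<omega> x)) (y - x))
      / norm (y - x) \<le> \<bar>B\<bar> * norm (y - x)"
    using \<open>y \<noteq> x\<close> by (simp add: divide_le_eq)
qed simp

text \<open>The almost sure bound on \<open>X\<close> also bounds its mean, so the deviation is at
  most twice that bound. Its square is at most eight times the sum of the two squares, and 9, the
  square of 3, is the next perfect square.\<close>

lemma (in prob_space) expectation_square_norm_centered:
  fixes X :: "'a \<Rightarrow> 'b::{banach, second_countable_topology}"
  assumes "integrable M X" "AE \<omega> in M. norm (X \<omega>) \<le> \<alpha> + \<beta> * t"
  shows "integrable M (\<lambda>\<omega>. (norm (X \<omega> - expectation X))\<^sup>2)"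
    and "expectation (\<lambda>\<omega>. (norm (X \<omega> - expectation X))\<^sup>2) \<le> (3 * \<alpha>)\<^sup>2 + (3 * \<beta>)\<^sup>2 * t\<^sup>2"
proof -
  have "norm (expectation X) \<le> \<alpha> + \<beta> * t"
    using assms by (rule norm_expectation_le)
  have ae: "AE \<omega> in M. (norm (X \<omega> - expectation X))\<^sup>2 \<le> (3 * \<alpha>)\<^sup>2 + (3 * \<beta>)\<^sup>2 * t\<^sup>2"
    using assms(2)
  proof eventually_elim
    case (elim \<omega>)
    have "norm (X \<omega> - expectation X) \<le> 2 * (\<alpha> + \<beta> * t)"
      using norm_triangle_ineq4[of "X \<omega>" "expectation X"] elim \<open>norm (expectation X) \<le> _\<close> by simp
    then have "(norm (X \<omega> - expectation X))\<^sup>2 \<le> (2 * (\<alpha> + \<beta> * t))\<^sup>2"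
      by (intro power_mono) auto
    also have "\<dots> \<le> (3 * \<alpha>)\<^sup>2 + (3 * \<beta>)\<^sup>2 * t\<^sup>2"
    proof -
      have "0 \<le> (\<alpha> - \<beta> * t)\<^sup>2 * 4" "0 \<le> \<alpha>\<^sup>2" "0 \<le> (\<beta> * t)\<^sup>2"
        by simp_all
      moreover have "(3 * \<alpha>)\<^sup>2 + (3 * \<beta>)\<^sup>2 * t\<^sup>2 - (2 * (\<alpha> + \<beta> * t))\<^sup>2
          = (\<alpha> - \<beta> * t)\<^sup>2 * 4 + \<alpha>\<^sup>2 + (\<beta> * t)\<^sup>2"
        by (simp add: power2_eq_square algebra_simps)
      ultimately show ?thesis
        by linarith
    qed
    finally show ?case .
  qed
  show int: "integrable M (\<lambda>\<omega>. (norm (X \<omega> - expectation X))\<^sup>2)"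
    by (rule integrable_const_bound[where B = "(3 * \<alpha>)\<^sup>2 + (3 * \<beta>)\<^sup>2 * t\<^sup>2"]) (use ae assms(1) in auto)
  show "expectation (\<lambda>\<omega>. (norm (X \<omega> - expectation X))\<^sup>2) \<le> (3 * \<alpha>)\<^sup>2 + (3 * \<beta>)\<^sup>2 * t\<^sup>2"
    using integral_mono_AE[OF int integrable_const[of "(3 * \<alpha>)\<^sup>2 + (3 * \<beta>)\<^sup>2 * t\<^sup>2"] ae]
    by (simp add: prob_space)
qed

subsection \<open>Compositions with a scalar function\<close>

locale composite_loss = prob_space P for P :: "'x measure" +
  fixes v :: "'x \<Rightarrow> 'a::euclidean_space \<Rightarrow> real" and h :: "real \<Rightarrow> real"
    and lam A B C N\<^sub>1 N\<^sub>2 R :: real and e :: 'a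
    \<comment> \<open>In the application \<open>v \<xi> (x, \<eta>) = l x \<xi> - \<eta>\<close> and \<open>e = (0, 1)\<close>.\<close>
  assumes lam_pos: "lam > 0" and norm_e: "norm e = 1"
    and A_nonneg: "0 \<le> A" and B_nonneg: "0 \<le> B" and C_nonneg: "0 \<le> C"
    and N\<^sub>1_nonneg: "0 \<le> N\<^sub>1" and N\<^sub>2_nonneg: "0 \<le> N\<^sub>2"
    and measurable_v: "\<And>z. (\<lambda>\<xi>. v \<xi> z) \<in> borel_measurable P"
    and v_diff: "\<And>\<xi>. \<xi> \<in> space P \<Longrightarrow> twice_differentiable (v \<xi>)"
    and v_lipschitz: "\<And>\<xi> z y. \<xi> \<in> space P \<Longrightarrow> \<bar>v \<xi> z - v \<xi> y\<bar> \<le> A * norm (z - y)"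
    and grad_v_lipschitz: "\<And>\<xi> z y. \<xi> \<in> space P \<Longrightarrow>
      norm (grad (v \<xi>) z - grad (v \<xi>) y) \<le> B * norm (z - y)"
    and hess_v_lipschitz: "\<And>\<xi> z y. \<xi> \<in> space P \<Longrightarrow>
      norm (hess (v \<xi>) z - hess (v \<xi>) y) \<le> C * norm (z - y)"
    and grad_v_e: "\<And>\<xi> z. \<xi> \<in> space P \<Longrightarrow> grad (v \<xi>) z \<bullet> e = - 1"
    and v_range: "\<And>z. \<exists>a. AE \<xi> in P. a \<le> v \<xi> z \<and> v \<xi> z \<le> a + R"
    and h_diff: "\<And>t. h differentiable (at t)" and deriv_h_diff: "\<And>t. deriv h differentiable (at t)"
    and deriv_h_lipschitz: "\<And>s t. \<bar>deriv h s - deriv h t\<bar> \<le> N\<^sub>1 * \<bar>s - t\<bar>"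
    and deriv2_h_lipschitz: "\<And>s t. \<bar>deriv (deriv h) s - deriv (deriv h) t\<bar> \<le> N\<^sub>2 * \<bar>s - t\<bar>"
begin

definition loss :: "'x \<Rightarrow> 'a \<Rightarrow> real" where
  "loss \<xi> z = lam * h (v \<xi> z / lam) + z \<bullet> e"

text \<open>First derivative of \<open>\<lambda>t. lam * h (t / lam)\<close> at
  \<open>v \<xi> z\<close>; this is \<open>p u\<close> in the introductory text.\<close>

definition slope :: "'x \<Rightarrow> 'a \<Rightarrow> real" where
  "slope \<xi> z = deriv h (v \<xi> z / lam)"

text \<open>Second derivative of the same function; the remaining factor \<open>1 / lam\<close>
  comes from the chain rule.\<close>

definition curvature :: "'x \<Rightarrow> 'a \<Rightarrow> real" where
  "curvature \<xi> z = deriv (deriv h) (v \<xi> z / lam) / lam"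

definition objective :: "'a \<Rightarrow> real" where
  "objective z = expectation (\<lambda>\<xi>. loss \<xi> z)"

section \<open>Derivatives of the loss\<close>

lemma DERIV_h: "(h has_real_derivative deriv h t) (at t)"
  using h_diff by (simp add: DERIV_deriv_iff_real_differentiable)

lemma DERIV_deriv_h: "(deriv h has_real_derivative deriv (deriv h) t) (at t)"
  using deriv_h_diff by (simp add: DERIV_deriv_iff_real_differentiable)

lemma abs_deriv2_h_le: "\<bar>deriv (deriv h) t\<bar> \<le> N\<^sub>1"
  using derivative_bound_of_lipschitz[of "deriv h" "(*) (deriv (deriv h) t)" t N\<^sub>1 1]
    DERIV_deriv_h[of t] deriv_h_lipschitz by (simp add: has_field_derivative_def)

lemma abs_curvature_le: "\<bar>curvature \<xi> z\<bar> \<le> N\<^sub>1 / lam"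
  unfolding curvature_def using abs_deriv2_h_le lam_pos by (simp add: divide_right_mono)

lemma has_derivative_v:
  assumes "\<xi> \<in> space P"
  shows "(v \<xi> has_derivative (\<lambda>a. a \<bullet> grad (v \<xi>) z)) (at z)"
  using GDERIV_grad v_diff[OF assms] unfolding twice_differentiable_def gderiv_def by blast

lemma has_derivative_grad_v:
  assumes "\<xi> \<in> space P"
  shows "(grad (v \<xi>) has_derivative hess (v \<xi>) z) (at z)"
  using has_derivative_hess v_diff[OF assms] unfolding twice_differentiable_def by blast

lemma norm_grad_v_le: "\<xi> \<in> space P \<Longrightarrow> norm (grad (v \<xi>) z) \<le> A"
  using v_diff v_lipschitz A_nonneg unfolding twice_differentiable_def by (intro norm_grad_le) auto

lemma norm_hess_v_le: "\<xi> \<in> space P \<Longrightarrow> norm (hess (v \<xi>) z) \<le> B"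
  using v_diff grad_v_lipschitz B_nonneg unfolding twice_differentiable_def by (intro norm_hess_le) auto

lemma norm_hess_v_apply_le: "\<xi> \<in> space P \<Longrightarrow> norm (hess (v \<xi>) z a) \<le> B * norm a"
  by (rule order_trans[OF norm_blinfun mult_right_mono[OF norm_hess_v_le norm_ge_zero]])

text \<open>Chain rule: the outer factor \<open>lam\<close> cancels the inner
  \<open>1 / lam\<close>.\<close>

lemma GDERIV_loss:
  assumes "\<xi> \<in> space P"
  shows "GDERIV (loss \<xi>) z :> slope \<xi> z *\<^sub>R grad (v \<xi>) z + e"
proof -
  have "((\<lambda>z. h (v \<xi> z / lam)) has_derivative (\<lambda>a. (a \<bullet> grad (v \<xi>) z) / lam * deriv h (v \<xi> z / lam))) (at z)"
    using DERIV_h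
    by (rule DERIV_compose_FDERIV) (use lam_pos in \<open>auto intro!: derivative_eq_intros has_derivative_v assms\<close>)
  then show ?thesis
    unfolding loss_def gderiv_def slope_def using lam_pos
    by (auto intro!: derivative_eq_intros simp: inner_add_right)
qed

lemma loss_differentiable: "\<xi> \<in> space P \<Longrightarrow> loss \<xi> differentiable (at z)"
  using GDERIV_loss unfolding gderiv_def differentiable_def by blast

lemma grad_loss: "\<xi> \<in> space P \<Longrightarrow> grad (loss \<xi>) z = slope \<xi> z *\<^sub>R grad (v \<xi>) z + e"
  by (rule grad_eqI[OF GDERIV_loss])

text \<open>Product rule. As a matrix, the Hessian is the slope times
  \<open>hess (v \<xi>) z\<close> plus the curvature times the outer product of
  \<open>grad (v \<xi>) z\<close> with itself.\<close>

lemma has_derivative_grad_loss: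
  assumes "\<xi> \<in> space P"
  shows "(grad (loss \<xi>) has_derivative
    (\<lambda>a. slope \<xi> z *\<^sub>R hess (v \<xi>) z a + (curvature \<xi> z * (a \<bullet> grad (v \<xi>) z)) *\<^sub>R grad (v \<xi>) z)) (at z)"
proof -
  have "(slope \<xi> has_derivative (\<lambda>a. curvature \<xi> z * (a \<bullet> grad (v \<xi>) z))) (at z)"
  proof -
    have "((\<lambda>z. deriv h (v \<xi> z / lam)) has_derivative
        (\<lambda>a. (a \<bullet> grad (v \<xi>) z) / lam * deriv (deriv h) (v \<xi> z / lam))) (at z)"
      using DERIV_deriv_h
      by (rule DERIV_compose_FDERIV) (use lam_pos in \<open>auto intro!: derivative_eq_intros has_derivative_v assms\<close>)
    then show ?thesis
      by (simp add: slope_def[abs_def] curvature_def mult.commute)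
  qed
  then have "((\<lambda>z. slope \<xi> z *\<^sub>R grad (v \<xi>) z + e) has_derivative
    (\<lambda>a. slope \<xi> z *\<^sub>R hess (v \<xi>) z a + (curvature \<xi> z * (a \<bullet> grad (v \<xi>) z)) *\<^sub>R grad (v \<xi>) z)) (at z)"
    by (auto intro!: derivative_eq_intros has_derivative_grad_v assms)
  then show ?thesis
    using grad_loss[OF assms] by presburger
qed

lemma grad_loss_differentiable: "\<xi> \<in> space P \<Longrightarrow> grad (loss \<xi>) differentiable (at z)"
  using has_derivative_grad_loss unfolding differentiable_def by blast

lemma hess_loss_apply:
  assumes "\<xi> \<in> space P"
  shows "hess (loss \<xi>) z a
    = slope \<xi> z *\<^sub>R hess (v \<xi>) z a + (curvature \<xi> z * (a \<bullet> grad (v \<xi>) z)) *\<^sub>R grad (v \<xi>) z"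
  using has_derivative_unique[OF has_derivative_hess[OF grad_loss_differentiable] has_derivative_grad_loss]
    assms by metis

section \<open>Pointwise bounds that are affine in the absolute slope\<close>

lemma slope_lipschitz:
  assumes "\<xi> \<in> space P"
  shows "\<bar>slope \<xi> z - slope \<xi> y\<bar> \<le> N\<^sub>1 * A / lam * norm (z - y)"
proof -
  have "\<bar>slope \<xi> z - slope \<xi> y\<bar> \<le> N\<^sub>1 * \<bar>v \<xi> z / lam - v \<xi> y / lam\<bar>"
    unfolding slope_def by (rule deriv_h_lipschitz)
  also have "\<dots> = N\<^sub>1 / lam * \<bar>v \<xi> z - v \<xi> y\<bar>"
    using lam_pos by (simp add: diff_divide_distrib[symmetric])
  also have "\<dots> \<le> N\<^sub>1 / lam * (A * norm (z - y))"
    using v_lipschitz[OF assms] N\<^sub>1_nonneg lam_pos by (intro mult_left_mono) auto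
  finally show ?thesis
    by simp
qed

lemma curvature_lipschitz:
  assumes "\<xi> \<in> space P"
  shows "\<bar>curvature \<xi> z - curvature \<xi> y\<bar> \<le> N\<^sub>2 * A / lam\<^sup>2 * norm (z - y)"
proof -
  have "\<bar>curvature \<xi> z - curvature \<xi> y\<bar> \<le> N\<^sub>2 * \<bar>v \<xi> z / lam - v \<xi> y / lam\<bar> / lam"
    unfolding curvature_def
    using divide_right_mono[OF deriv2_h_lipschitz[of "v \<xi> z / lam" "v \<xi> y / lam"], of lam] lam_pos
    by (simp add: diff_divide_distrib[symmetric])
  also have "\<dots> = N\<^sub>2 / lam\<^sup>2 * \<bar>v \<xi> z - v \<xi> y\<bar>"
    using lam_pos by (simp add: diff_divide_distrib[symmetric] power2_eq_square)
  also have "\<dots> \<le> N\<^sub>2 / lam\<^sup>2 * (A * norm (z - y))"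
    using v_lipschitz[OF assms] N\<^sub>2_nonneg lam_pos by (intro mult_left_mono) auto
  finally show ?thesis
    by simp
qed

lemma norm_grad_loss_le:
  assumes "\<xi> \<in> space P"
  shows "norm (grad (loss \<xi>) z) \<le> 1 + A * \<bar>slope \<xi> z\<bar>"
proof -
  have "norm (grad (loss \<xi>) z) \<le> \<bar>slope \<xi> z\<bar> * norm (grad (v \<xi>) z) + 1"
    using norm_triangle_ineq[of "slope \<xi> z *\<^sub>R grad (v \<xi>) z" e] norm_e
    by (simp add: grad_loss[OF assms])
  also have "\<dots> \<le> \<bar>slope \<xi> z\<bar> * A + 1"
    by (intro add_right_mono mult_left_mono norm_grad_v_le assms) simp
  finally show ?thesis
    by (simp add: mult.commute)
qed

lemma grad_loss_lipschitz:
  assumes "\<xi> \<in> space P"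
  shows "norm (grad (loss \<xi>) z - grad (loss \<xi>) y)
    \<le> (N\<^sub>1 * A\<^sup>2 / lam + B * \<bar>slope \<xi> z\<bar>) * norm (z - y)"
proof -
  let ?w = "grad (v \<xi>)" and ?p = "slope \<xi>"
  \<comment> \<open>The telescoping is arranged so that the slope, which has no uniform bound,
    occurs on its own only at \<open>z\<close>; otherwise it enters through a Lipschitz
    difference.\<close>
  have "grad (loss \<xi>) z - grad (loss \<xi>) y = ?p z *\<^sub>R (?w z - ?w y) + (?p z - ?p y) *\<^sub>R ?w y"
    by (simp add: grad_loss[OF assms] algebra_simps)
  then have "norm (grad (loss \<xi>) z - grad (loss \<xi>) y)
      \<le> \<bar>?p z\<bar> * norm (?w z - ?w y) + \<bar>?p z - ?p y\<bar> * norm (?w y)"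
    by (metis norm_triangle_ineq norm_scaleR)
  also have "\<dots> \<le> \<bar>?p z\<bar> * (B * norm (z - y)) + (N\<^sub>1 * A / lam * norm (z - y)) * A"
    by (intro add_mono mult_left_mono mult_mono grad_v_lipschitz slope_lipschitz norm_grad_v_le assms)
       (use N\<^sub>1_nonneg A_nonneg lam_pos in auto)
  finally show ?thesis
    by (simp add: algebra_simps power2_eq_square)
qed

text \<open>The Lipschitz constant of the gradient anchored at \<open>z\<close>, from
  \<open>grad_loss_lipschitz\<close>, bounds the derivative at \<open>z\<close>.\<close>

lemma norm_hess_loss_le:
  assumes "\<xi> \<in> space P"
  shows "norm (hess (loss \<xi>) z) \<le> N\<^sub>1 * A\<^sup>2 / lam + B * \<bar>slope \<xi> z\<bar>"
  using N\<^sub>1_nonneg B_nonneg lam_pos grad_loss_lipschitz[OF assms, of z]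
  by (intro norm_hess_le grad_loss_differentiable assms)
     (auto simp: norm_minus_commute)

lemma hess_loss_lipschitz:
  assumes "\<xi> \<in> space P"
  shows "norm (hess (loss \<xi>) z - hess (loss \<xi>) y)
    \<le> (N\<^sub>2 * A ^ 3 / lam\<^sup>2 + 3 * (N\<^sub>1 * A * B / lam) + C * \<bar>slope \<xi> z\<bar>) * norm (z - y)"
proof (rule norm_blinfun_bound)
  let ?w = "grad (v \<xi>)" and ?p = "slope \<xi>" and ?q = "curvature \<xi>" and ?H = "hess (v \<xi>)"
  show "0 \<le> (N\<^sub>2 * A ^ 3 / lam\<^sup>2 + 3 * (N\<^sub>1 * A * B / lam) + C * \<bar>slope \<xi> z\<bar>) * norm (z - y)"
    using N\<^sub>1_nonneg N\<^sub>2_nonneg A_nonneg B_nonneg C_nonneg lam_pos by simp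
  fix a :: 'a
  have inner_le: "\<bar>a \<bullet> ?w x\<bar> \<le> norm a * A" for x
    by (rule order_trans[OF Cauchy_Schwarz_ineq2 mult_left_mono[OF norm_grad_v_le[OF assms] norm_ge_zero]])
  have inner_diff_le: "\<bar>a \<bullet> (?w z - ?w y)\<bar> \<le> norm a * (B * norm (z - y))"
    by (rule order_trans[OF Cauchy_Schwarz_ineq2 mult_left_mono[OF grad_v_lipschitz[OF assms] norm_ge_zero]])
  have norm_sum5: "norm (b + c + d + f + g) \<le> norm b + norm c + norm d + norm f + norm g" for b c d f g :: 'a
    using norm_triangle_ineq[of "b + c + d + f" g] norm_triangle_ineq[of "b + c + d" f]
      norm_triangle_ineq[of "b + c" d] norm_triangle_ineq[of b c] by linarith
  \<comment> \<open>Each summand changes one factor at a time. The first yields the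
    \<open>C * \<bar>slope \<xi> z\<bar>\<close> term and the third the
    \<open>N\<^sub>2 * A ^ 3\<close> term. The other three are each bounded by
    \<open>N\<^sub>1 * A * B / lam\<close> times the two norms, whence the factor 3.\<close>
  have eq: "blinfun_apply (hess (loss \<xi>) z - hess (loss \<xi>) y) a
      = ?p z *\<^sub>R (?H z - ?H y) a + (?p z - ?p y) *\<^sub>R ?H y a
        + ((?q z - ?q y) * (a \<bullet> ?w z)) *\<^sub>R ?w z
        + (?q y * (a \<bullet> (?w z - ?w y))) *\<^sub>R ?w z + (?q y * (a \<bullet> ?w y)) *\<^sub>R (?w z - ?w y)"
    by (simp add: blinfun.diff_left hess_loss_apply[OF assms] algebra_simps inner_diff_right)
  have "norm (blinfun_apply (hess (loss \<xi>) z - hess (loss \<xi>) y) a)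
      \<le> \<bar>?p z\<bar> * norm ((?H z - ?H y) a) + \<bar>?p z - ?p y\<bar> * norm (?H y a)
        + \<bar>?q z - ?q y\<bar> * \<bar>a \<bullet> ?w z\<bar> * norm (?w z)
        + \<bar>?q y\<bar> * \<bar>a \<bullet> (?w z - ?w y)\<bar> * norm (?w z) + \<bar>?q y\<bar> * \<bar>a \<bullet> ?w y\<bar> * norm (?w z - ?w y)"
    unfolding eq by (rule order_trans[OF norm_sum5]) (simp add: abs_mult)
  also have "\<dots> \<le> \<bar>?p z\<bar> * (C * norm (z - y) * norm a) + (N\<^sub>1 * A / lam * norm (z - y)) * (B * norm a)
        + (N\<^sub>2 * A / lam\<^sup>2 * norm (z - y)) * (norm a * A) * A
        + N\<^sub>1 / lam * (norm a * (B * norm (z - y))) * A + N\<^sub>1 / lam * (norm a * A) * (B * norm (z - y))"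
  proof (intro add_mono)
    show "\<bar>?p z\<bar> * norm ((?H z - ?H y) a) \<le> \<bar>?p z\<bar> * (C * norm (z - y) * norm a)"
      by (intro mult_left_mono order_trans[OF norm_blinfun] mult_right_mono hess_v_lipschitz assms) auto
    show "\<bar>?p z - ?p y\<bar> * norm (?H y a) \<le> (N\<^sub>1 * A / lam * norm (z - y)) * (B * norm a)"
      using N\<^sub>1_nonneg A_nonneg lam_pos by (intro mult_mono slope_lipschitz norm_hess_v_apply_le assms) auto
    show "\<bar>?q z - ?q y\<bar> * \<bar>a \<bullet> ?w z\<bar> * norm (?w z) \<le> (N\<^sub>2 * A / lam\<^sup>2 * norm (z - y)) * (norm a * A) * A"
      using N\<^sub>1_nonneg N\<^sub>2_nonneg A_nonneg lam_pos by (intro mult_mono curvature_lipschitz inner_le norm_grad_v_le assms) auto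
    show "\<bar>?q y\<bar> * \<bar>a \<bullet> (?w z - ?w y)\<bar> * norm (?w z) \<le> N\<^sub>1 / lam * (norm a * (B * norm (z - y))) * A"
      using N\<^sub>1_nonneg A_nonneg B_nonneg lam_pos by (intro mult_mono abs_curvature_le inner_diff_le norm_grad_v_le assms) auto
    show "\<bar>?q y\<bar> * \<bar>a \<bullet> ?w y\<bar> * norm (?w z - ?w y) \<le> N\<^sub>1 / lam * (norm a * A) * (B * norm (z - y))"
      using N\<^sub>1_nonneg N\<^sub>2_nonneg A_nonneg lam_pos by (intro mult_mono abs_curvature_le inner_le grad_v_lipschitz assms) auto
  qed
  also have "\<dots> = (N\<^sub>2 * A ^ 3 / lam\<^sup>2 + 3 * (N\<^sub>1 * A * B / lam) + C * \<bar>?p z\<bar>) * norm (z - y) * norm a"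
    by (simp add: algebra_simps power3_eq_cube)
  finally show "norm (blinfun_apply (hess (loss \<xi>) z - hess (loss \<xi>) y) a)
    \<le> (N\<^sub>2 * A ^ 3 / lam\<^sup>2 + 3 * (N\<^sub>1 * A * B / lam) + C * \<bar>?p z\<bar>) * norm (z - y) * norm a" .
qed

section \<open>Almost sure range of the slope, and integrability\<close>

lemma slope_range: "\<exists>p. AE \<xi> in P. \<bar>slope \<xi> z - p\<bar> \<le> N\<^sub>1 * R / lam"
proof -
  obtain a where a: "AE \<xi> in P. a \<le> v \<xi> z \<and> v \<xi> z \<le> a + R"
    using v_range by blast
  \<comment> \<open>The slope is compared with its value at the left end \<open>a\<close> of the
    range of \<open>v\<close>. This reference value depends on \<open>z\<close>, the radius does
    not.\<close>
  have "AE \<xi> in P. \<bar>slope \<xi> z - deriv h (a / lam)\<bar> \<le> N\<^sub>1 * R / lam"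
    using a
  proof eventually_elim
    case (elim \<xi>)
    have "\<bar>slope \<xi> z - deriv h (a / lam)\<bar> \<le> N\<^sub>1 * \<bar>v \<xi> z / lam - a / lam\<bar>"
      unfolding slope_def by (rule deriv_h_lipschitz)
    also have "\<dots> \<le> N\<^sub>1 * (R / lam)"
      using elim lam_pos N\<^sub>1_nonneg
      by (intro mult_left_mono) (auto simp: diff_divide_distrib[symmetric] divide_right_mono)
    finally show ?case
      by simp
  qed
  then show ?thesis
    by blast
qed

text \<open>Here \<open>k\<close> depends on \<open>z\<close> without control. That suffices for
  integrability and for differentiation at \<open>z\<close>; the constants of the final estimates
  come from \<open>AE_slope_le\<close>.\<close>

lemma slope_bounded: "\<exists>k. AE \<xi> in P. \<bar>slope \<xi> z\<bar> \<le> k"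
proof -
  obtain p where "AE \<xi> in P. \<bar>slope \<xi> z - p\<bar> \<le> N\<^sub>1 * R / lam"
    using slope_range by blast
  then have "AE \<xi> in P. \<bar>slope \<xi> z\<bar> \<le> \<bar>p\<bar> + N\<^sub>1 * R / lam"
    by eventually_elim linarith
  then show ?thesis
    by blast
qed

lemma AE_affine_slope_bound:
  assumes "\<And>\<xi>. \<xi> \<in> space P \<Longrightarrow> X \<xi> \<le> \<alpha> + \<beta> * \<bar>slope \<xi> z\<bar>" "0 \<le> \<beta>"
    and "AE \<xi> in P. \<bar>slope \<xi> z\<bar> \<le> k"
  shows "AE \<xi> in P. X \<xi> \<le> \<alpha> + \<beta> * k"
  using assms(3) AE_space
proof eventually_elim
  case (elim \<xi>)
  have "\<beta> * \<bar>slope \<xi> z\<bar> \<le> \<beta> * k"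
    using elim(1) assms(2) by (rule mult_left_mono)
  with assms(1)[OF elim(2)] show ?case
    by linarith
qed

lemma isCont_h: "isCont h t"
  using DERIV_h by (rule DERIV_isCont)

lemma measurable_loss: "(\<lambda>\<xi>. loss \<xi> z) \<in> borel_measurable P"
proof -
  have "h \<in> borel_measurable borel"
    by (intro borel_measurable_continuous_onI continuous_at_imp_continuous_on ballI isCont_h)
  then show ?thesis
    unfolding loss_def using measurable_v by measurable
qed

text \<open>Almost surely \<open>v \<xi> z / lam\<close> stays in a compact interval, on which the
  continuous \<open>h\<close> is bounded.\<close>

lemma integrable_loss: "integrable P (\<lambda>\<xi>. loss \<xi> z)"
proof -
  obtain a where a: "AE \<xi> in P. a \<le> v \<xi> z \<and> v \<xi> z \<le> a + R"
    using v_range by blast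
  have "compact (h ` {a / lam..(a + R) / lam})"
    by (intro compact_continuous_image continuous_at_imp_continuous_on ballI isCont_h) simp
  then obtain k where k: "\<And>t. a / lam \<le> t \<Longrightarrow> t \<le> (a + R) / lam \<Longrightarrow> \<bar>h t\<bar> \<le> k"
    by (fastforce dest!: compact_imp_bounded simp: bounded_iff)
  show ?thesis
  proof (rule integrable_const_bound)
    show "AE \<xi> in P. norm (loss \<xi> z) \<le> lam * k + \<bar>z \<bullet> e\<bar>"
      using a
    proof eventually_elim
      case (elim \<xi>)
      have "\<bar>loss \<xi> z\<bar> \<le> lam * \<bar>h (v \<xi> z / lam)\<bar> + \<bar>z \<bullet> e\<bar>"
        unfolding loss_def using abs_triangle_ineq[of "lam * h (v \<xi> z / lam)" "z \<bullet> e"] lam_pos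
        by (simp add: abs_mult)
      also have "\<dots> \<le> lam * k + \<bar>z \<bullet> e\<bar>"
        using elim lam_pos by (intro add_right_mono mult_left_mono k) (auto intro: divide_right_mono)
      finally show ?case
        by simp
    qed
  qed (rule measurable_loss)
qed

lemma integrable_of_affine_slope_bound:
  fixes X :: "'x \<Rightarrow> 'd::{banach, second_countable_topology}"
  assumes "X \<in> borel_measurable P" "0 \<le> \<beta>"
    and "\<And>\<xi>. \<xi> \<in> space P \<Longrightarrow> norm (X \<xi>) \<le> \<alpha> + \<beta> * \<bar>slope \<xi> z\<bar>"
  shows "integrable P X"
proof -
  obtain k where "AE \<xi> in P. \<bar>slope \<xi> z\<bar> \<le> k"
    using slope_bounded by blast
  from AE_affine_slope_bound[OF assms(3,2) this] assms(1) show ?thesis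
    by (intro integrable_const_bound) auto
qed

lemma measurable_grad_loss: "(\<lambda>\<xi>. grad (loss \<xi>) z) \<in> borel_measurable P"
  by (intro borel_measurable_grad measurable_loss loss_differentiable)

lemma integrable_grad_loss: "integrable P (\<lambda>\<xi>. grad (loss \<xi>) z)"
  by (rule integrable_of_affine_slope_bound[OF measurable_grad_loss A_nonneg norm_grad_loss_le])

lemma integrable_hess_loss: "integrable P (\<lambda>\<xi>. hess (loss \<xi>) z)"
  by (rule integrable_of_affine_slope_bound[OF _ B_nonneg norm_hess_loss_le])
     (intro borel_measurable_hess measurable_grad_loss grad_loss_differentiable)

text \<open>Supplies the Lipschitz hypothesis of \<open>has_derivative_expectation\<close>. The
  exceptional null set concerns only the slope at \<open>z\<close>, so one set serves all
  \<open>y\<close>.\<close>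

lemma AE_lipschitz_of_affine_slope_bound:
  fixes D :: "'x \<Rightarrow> 'a \<Rightarrow> 'd::real_normed_vector"
  assumes "\<And>\<xi> y. \<xi> \<in> space P \<Longrightarrow> norm (D \<xi> z - D \<xi> y) \<le> (\<alpha> + \<beta> * \<bar>slope \<xi> z\<bar>) * norm (z - y)"
    and "0 \<le> \<beta>"
  shows "\<exists>k. AE \<xi> in P. \<forall>y. norm (D \<xi> y - D \<xi> z) \<le> k * norm (y - z)"
proof -
  obtain k where k: "AE \<xi> in P. \<bar>slope \<xi> z\<bar> \<le> k"
    using slope_bounded by blast
  have "AE \<xi> in P. \<forall>y. norm (D \<xi> y - D \<xi> z) \<le> (\<alpha> + \<beta> * k) * norm (y - z)"
    using AE_affine_slope_bound[OF order_refl assms(2) k, of \<alpha>] AE_space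
  proof eventually_elim
    case (elim \<xi>)
    show ?case
    proof
      fix y
      show "norm (D \<xi> y - D \<xi> z) \<le> (\<alpha> + \<beta> * k) * norm (y - z)"
        using assms(1)[OF elim(2), of y] mult_right_mono[OF elim(1) norm_ge_zero[of "z - y"]]
        by (simp add: norm_minus_commute)
    qed
  qed
  then show ?thesis
    by blast
qed

section \<open>Derivatives of the objective\<close>

lemma GDERIV_objective: "GDERIV objective z :> expectation (\<lambda>\<xi>. grad (loss \<xi>) z)"
proof -
  obtain k where k: "AE \<xi> in P. \<forall>y. norm (grad (loss \<xi>) y - grad (loss \<xi>) z) \<le> k * norm (y - z)"
    using AE_lipschitz_of_affine_slope_bound[OF grad_loss_lipschitz B_nonneg] by blast
  \<comment> \<open>The pairing is the inner product with its arguments flipped, a vector acting as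
    a linear functional.\<close>
  have "((\<lambda>z. expectation (\<lambda>\<xi>. loss \<xi> z)) has_derivative
      (\<lambda>D a. a \<bullet> D) (expectation (\<lambda>\<xi>. grad (loss \<xi>) z))) (at z)"
  proof (rule has_derivative_expectation[where D = "\<lambda>\<xi>. grad (loss \<xi>)" and B = k])
    show "bounded_bilinear (\<lambda>(D::'a) a. a \<bullet> D)"
      by (rule bounded_bilinear.flip[OF bounded_bilinear_inner])
    show "norm (a \<bullet> D) \<le> norm D * norm a" for a D :: 'a
      using Cauchy_Schwarz_ineq2[of a D] by (simp add: mult.commute)
    show "(loss \<xi> has_derivative (\<lambda>a. a \<bullet> grad (loss \<xi>) y)) (at y)" if "\<xi> \<in> space P" for \<xi> y
      using GDERIV_grad[OF loss_differentiable[OF that]] unfolding gderiv_def .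
  qed (fact integrable_loss integrable_grad_loss k)+
  then show ?thesis
    unfolding gderiv_def objective_def[abs_def] .
qed

lemma grad_objective: "grad objective = (\<lambda>z. expectation (\<lambda>\<xi>. grad (loss \<xi>) z))"
  using grad_eqI[OF GDERIV_objective] by blast

text \<open>Second use of \<open>has_derivative_expectation\<close>, with the gradients of the
  losses as the functions and operator application as the pairing.\<close>

lemma has_derivative_grad_objective:
  "(grad objective has_derivative expectation (\<lambda>\<xi>. hess (loss \<xi>) z)) (at z)"
proof -
  obtain k where k: "AE \<xi> in P. \<forall>y. norm (hess (loss \<xi>) y - hess (loss \<xi>) z) \<le> k * norm (y - z)"
    using AE_lipschitz_of_affine_slope_bound[OF hess_loss_lipschitz C_nonneg] by blast
  show ?thesis
    unfolding grad_objective
  proof (rule has_derivative_expectation[where D = "\<lambda>\<xi>. hess (loss \<xi>)" and B = k])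
    show "(grad (loss \<xi>) has_derivative hess (loss \<xi>) y) (at y)" if "\<xi> \<in> space P" for \<xi> y
      by (rule has_derivative_hess[OF grad_loss_differentiable[OF that]])
  qed (fact bounded_bilinear_blinfun_apply norm_blinfun integrable_grad_loss integrable_hess_loss k)+
qed

lemma hess_objective: "hess objective z = expectation (\<lambda>\<xi>. hess (loss \<xi>) z)"
  by (rule hess_eqI[OF has_derivative_grad_objective])

lemma twice_differentiable_objective: "twice_differentiable objective"
  unfolding twice_differentiable_def
  by (intro conjI allI differentiableI[OF GDERIV_objective[unfolded gderiv_def]]
      differentiableI[OF has_derivative_grad_objective])

section \<open>Control of the slope by the gradient of the objective\<close>

definition slack :: real where
  "slack = 1 + 2 * (N\<^sub>1 * R / lam)"

text \<open>Since \<open>grad (v \<xi>) z \<bullet> e = - 1\<close>, the mean of the slope is \<open>1 - grad objective z \<bullet> e\<close>, and the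
  slope deviates from its mean by at most \<open>2 * (N\<^sub>1 * R / lam)\<close>.\<close>

lemma AE_slope_le: "AE \<xi> in P. \<bar>slope \<xi> z\<bar> \<le> slack + norm (grad objective z)"
proof -
  obtain p where p: "AE \<xi> in P. \<bar>slope \<xi> z - p\<bar> \<le> N\<^sub>1 * R / lam"
    using slope_range by blast
  have slope_eq: "slope \<xi> z = 1 - grad (loss \<xi>) z \<bullet> e" if "\<xi> \<in> space P" for \<xi>
    using norm_e by (simp add: grad_loss[OF that] inner_add_left grad_v_e[OF that] power2_norm_eq_inner[symmetric])
  have int: "integrable P (\<lambda>\<xi>. 1 - grad (loss \<xi>) z \<bullet> e)"
    using integrable_grad_loss by simp
  have "\<bar>expectation (\<lambda>\<xi>. 1 - grad (loss \<xi>) z \<bullet> e - p)\<bar> \<le> N\<^sub>1 * R / lam"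
  proof -
    have "AE \<xi> in P. norm (1 - grad (loss \<xi>) z \<bullet> e - p) \<le> N\<^sub>1 * R / lam"
      using p AE_space by eventually_elim (simp add: slope_eq)
    then show ?thesis
      using norm_expectation_le[of "\<lambda>\<xi>. 1 - grad (loss \<xi>) z \<bullet> e - p"] int by simp
  qed
  moreover have "expectation (\<lambda>\<xi>. 1 - grad (loss \<xi>) z \<bullet> e - p) = 1 - grad objective z \<bullet> e - p"
    using integrable_grad_loss by (simp add: grad_objective prob_space)
  moreover have "\<bar>grad objective z \<bullet> e\<bar> \<le> norm (grad objective z)"
    using Cauchy_Schwarz_ineq2[of "grad objective z" e] norm_e by simp
  \<comment> \<open>\<open>p\<close> is within \<open>N\<^sub>1 * R / lam\<close> of the mean slope,
    and the slope is almost surely within the same distance of \<open>p\<close>. Adding the two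
    gives the factor 2 in \<open>slack\<close>.\<close>
  ultimately have "\<bar>p\<bar> \<le> 1 + N\<^sub>1 * R / lam + norm (grad objective z)"
    by linarith
  with p show ?thesis
    unfolding slack_def by (auto elim!: eventually_mono)
qed

lemma AE_affine_grad_objective_bound:
  assumes "\<And>\<xi>. \<xi> \<in> space P \<Longrightarrow> X \<xi> \<le> \<alpha> + \<beta> * \<bar>slope \<xi> z\<bar>" "0 \<le> \<beta>"
  shows "AE \<xi> in P. X \<xi> \<le> (\<alpha> + \<beta> * slack) + \<beta> * norm (grad objective z)"
  using AE_affine_slope_bound[OF assms AE_slope_le] by (simp add: algebra_simps)

text \<open>Common source of both smoothness conditions: \<open>AE_slope_le\<close> trades the
  random slope for the gradient norm of the objective, which is constant under the
  expectation.\<close>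

lemma expectation_lipschitz_of_affine_slope_bound:
  fixes D :: "'x \<Rightarrow> 'a \<Rightarrow> 'd::{banach, second_countable_topology}"
  assumes "\<And>z. integrable P (\<lambda>\<xi>. D \<xi> z)" "0 \<le> \<beta>"
    and "\<And>\<xi> z y. \<xi> \<in> space P \<Longrightarrow> norm (D \<xi> z - D \<xi> y) \<le> (\<alpha> + \<beta> * \<bar>slope \<xi> z\<bar>) * norm (z - y)"
  shows "norm (expectation (\<lambda>\<xi>. D \<xi> z) - expectation (\<lambda>\<xi>. D \<xi> y))
    \<le> (\<alpha> + \<beta> * slack + \<beta> * norm (grad objective z)) * norm (z - y)"
proof -
  have "AE \<xi> in P. norm (D \<xi> z - D \<xi> y)
      \<le> (\<alpha> + \<beta> * slack + \<beta> * norm (grad objective z)) * norm (z - y)"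
    using AE_affine_grad_objective_bound[OF order_refl assms(2), of \<alpha> z] AE_space
  proof eventually_elim
    case (elim \<xi>)
    show ?case
      using assms(3)[OF elim(2)] mult_right_mono[OF elim(1) norm_ge_zero] by (rule order_trans)
  qed
  then have "norm (expectation (\<lambda>\<xi>. D \<xi> z - D \<xi> y))
      \<le> (\<alpha> + \<beta> * slack + \<beta> * norm (grad objective z)) * norm (z - y)"
    using assms(1) by (intro norm_expectation_le) auto
  then show ?thesis
    using assms(1) by simp
qed

section \<open>The smoothness and variance conditions\<close>

lemma gen_smooth_objective: "\<exists>L\<^sub>0 L\<^sub>1. L\<^sub>0 > 0 \<and> L\<^sub>1 \<ge> 0 \<and> gen_smooth objective L\<^sub>0 L\<^sub>1"
proof (intro exI conjI)
  let ?\<alpha> = "N\<^sub>1 * A\<^sup>2 / lam + B * slack"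
  \<comment> \<open>The summand \<open>1\<close> makes the constant strictly positive; the absolute
    value avoids a discussion of the sign of \<open>slack\<close>.\<close>
  show "gen_smooth objective (1 + \<bar>?\<alpha>\<bar>) B"
    unfolding gen_smooth_def
  proof (intro conjI allI impI)
    show "objective differentiable (at z)" for z
      using twice_differentiable_objective unfolding twice_differentiable_def by blast
    fix z y
    have "norm (grad objective z - grad objective y)
        \<le> (?\<alpha> + B * norm (grad objective z)) * norm (z - y)"
      unfolding grad_objective
      using expectation_lipschitz_of_affine_slope_bound[OF integrable_grad_loss B_nonneg grad_loss_lipschitz]
      by (simp add: grad_objective)
    also have "\<dots> \<le> (1 + \<bar>?\<alpha>\<bar> + B * norm (grad objective z)) * norm (z - y)"
      by (intro mult_right_mono add_right_mono norm_ge_zero) (rule add_increasing[OF zero_le_one abs_ge_self])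
    finally show "norm (grad objective z - grad objective y)
        \<le> (1 + \<bar>?\<alpha>\<bar> + B * norm (grad objective z)) * norm (z - y)" .
  qed
qed (use B_nonneg in auto)

lemma gen_hess_smooth_objective:
  "\<exists>\<delta> M\<^sub>0 M\<^sub>1. \<delta> > 0 \<and> M\<^sub>0 > 0 \<and> M\<^sub>1 \<ge> 0 \<and> gen_hess_smooth objective \<delta> M\<^sub>0 M\<^sub>1"
proof (intro exI conjI)
  let ?\<alpha> = "N\<^sub>2 * A ^ 3 / lam\<^sup>2 + 3 * (N\<^sub>1 * A * B / lam) + C * slack"
  \<comment> \<open>The radius \<open>1\<close> is an arbitrary choice, as the estimate is proved
    for all pairs of points.\<close>
  show "gen_hess_smooth objective 1 (1 + \<bar>?\<alpha>\<bar>) C"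
    unfolding gen_hess_smooth_def
  proof (intro allI impI)
    fix z y
    have "norm (hess objective z - hess objective y)
        \<le> (?\<alpha> + C * norm (grad objective z)) * norm (z - y)"
      unfolding hess_objective
      by (rule expectation_lipschitz_of_affine_slope_bound[OF integrable_hess_loss C_nonneg hess_loss_lipschitz])
    also have "\<dots> \<le> (1 + \<bar>?\<alpha>\<bar> + C * norm (grad objective z)) * norm (z - y)"
      by (intro mult_right_mono add_right_mono norm_ge_zero) (rule add_increasing[OF zero_le_one abs_ge_self])
    finally show "norm (hess objective z - hess objective y)
        \<le> (1 + \<bar>?\<alpha>\<bar> + C * norm (grad objective z)) * norm (z - y)" .
  qed
qed (use C_nonneg in auto)

lemma gen_grad_variance_objective:
  "\<exists>G\<^sub>0 G\<^sub>1. G\<^sub>0 \<ge> 0 \<and> G\<^sub>1 \<ge> 0 \<and> gen_grad_variance objective loss P G\<^sub>0 G\<^sub>1"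
proof (intro exI conjI)
  let ?\<alpha> = "1 + A * slack"
  have var: "AE \<xi> in P. norm (grad (loss \<xi>) z) \<le> ?\<alpha> + A * norm (grad objective z)" for z
    by (rule AE_affine_grad_objective_bound[OF norm_grad_loss_le A_nonneg])
  \<comment> \<open>The factors 3 come from \<open>expectation_square_norm_centered\<close>; the
    absolute value secures nonnegativity and leaves the square unchanged.\<close>
  show "gen_grad_variance objective loss P \<bar>3 * ?\<alpha>\<bar> (3 * A)"
    unfolding gen_grad_variance_def
    using expectation_square_norm_centered[OF integrable_grad_loss var] integrable_grad_loss loss_differentiable
    by (simp add: grad_objective)
qed (use A_nonneg in auto)

lemma gen_hess_variance_objective:
  "\<exists>K\<^sub>0 K\<^sub>1. K\<^sub>0 \<ge> 0 \<and> K\<^sub>1 \<ge> 0 \<and> gen_hess_variance objective loss P K\<^sub>0 K\<^sub>1"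
proof (intro exI conjI)
  let ?\<alpha> = "N\<^sub>1 * A\<^sup>2 / lam + B * slack"
  have var: "AE \<xi> in P. norm (hess (loss \<xi>) z) \<le> ?\<alpha> + B * norm (grad objective z)" for z
    by (rule AE_affine_grad_objective_bound[OF norm_hess_loss_le B_nonneg])
  show "gen_hess_variance objective loss P \<bar>3 * ?\<alpha>\<bar> (3 * B)"
    unfolding gen_hess_variance_def twice_differentiable_def
    using expectation_square_norm_centered[OF integrable_hess_loss var] integrable_hess_loss
      loss_differentiable grad_loss_differentiable
    by (simp add: hess_objective)
qed (use B_nonneg in auto)

end

subsection \<open>The dual DRO loss\<close>

text \<open>The constant component \<open>- 1\<close> is what makes \<open>e = (0, 1)\<close> meet
  the requirement \<open>grad_v_e\<close>.\<close>

lemma GDERIV_minus_snd: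
  assumes "\<phi> differentiable (at (fst z))"
  shows "GDERIV (\<lambda>z. \<phi> (fst z) - snd z) z :> (grad \<phi> (fst z), - 1)"
proof -
  have "((\<lambda>z. \<phi> (fst z)) has_derivative (\<lambda>a. fst a \<bullet> grad \<phi> (fst z))) (at z)"
    by (rule has_derivative_compose[where f = fst and g = \<phi>])
       (use GDERIV_grad[OF assms] in \<open>auto simp: gderiv_def intro!: derivative_eq_intros\<close>)
  then show ?thesis
    unfolding gderiv_def by (auto intro!: derivative_eq_intros simp: inner_prod_def)
qed

lemma grad_minus_snd:
  assumes "\<And>x. \<phi> differentiable (at x)"
  shows "grad (\<lambda>z. \<phi> (fst z) - snd z) = (\<lambda>z. (grad \<phi> (fst z), - 1))"
  using grad_eqI[OF GDERIV_minus_snd[OF assms]] by blast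

text \<open>The last component of the gradient is constant, so the Hessian is that of
  \<open>\<phi>\<close> bordered by zeros.\<close>

lemma has_derivative_grad_minus_snd:
  assumes "twice_differentiable \<phi>"
  shows "(grad (\<lambda>z. \<phi> (fst z) - snd z) has_derivative (\<lambda>a. (hess \<phi> (fst z) (fst a), 0))) (at z)"
proof -
  have diff: "\<phi> differentiable (at x)" "grad \<phi> differentiable (at x)" for x
    using assms unfolding twice_differentiable_def by auto
  have "((\<lambda>z. grad \<phi> (fst z)) has_derivative (\<lambda>a. hess \<phi> (fst z) (fst a))) (at z)"
    by (rule has_derivative_compose[where f = fst and g = "grad \<phi>"])
       (use has_derivative_hess[OF diff(2)] in \<open>auto intro!: derivative_eq_intros\<close>)
  then show ?thesis
    unfolding grad_minus_snd[OF diff(1)] by (rule has_derivative_Pair) (rule has_derivative_const)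
qed

lemma twice_differentiable_minus_snd:
  assumes "twice_differentiable \<phi>"
  shows "twice_differentiable (\<lambda>z. \<phi> (fst z) - snd z)"
  using assms unfolding twice_differentiable_def
  by (intro conjI allI differentiableI[OF has_derivative_grad_minus_snd[OF assms]]
      differentiableI[OF GDERIV_minus_snd[unfolded gderiv_def]]) blast

lemma hess_minus_snd_apply:
  assumes "twice_differentiable \<phi>"
  shows "hess (\<lambda>z. \<phi> (fst z) - snd z) z a = (hess \<phi> (fst z) (fst a), 0)"
  using has_derivative_unique[OF has_derivative_hess has_derivative_grad_minus_snd[OF assms]]
    twice_differentiable_minus_snd[OF assms] unfolding twice_differentiable_def by metis

lemma norm_fst_le_norm: "norm (fst z) \<le> norm z"
  by (cases z) (simp add: norm_Pair)

lemma norm_snd_le_norm: "norm (snd z) \<le> norm z"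
  by (cases z) (simp add: norm_Pair)

theorem theorem3:
  fixes P :: "'x measure"
    and l :: "real ^ 'n \<Rightarrow> 'x \<Rightarrow> real"
    and \<psi> :: "real \<Rightarrow> ereal"
    and lam G L M N\<^sub>1 N\<^sub>2 \<sigma> m Mbar \<delta>\<^sub>0 :: real
  assumes "prob_space P"
    and "lam > 0"
    and "valid_divergence \<psi>"
    and "\<And>x. l x \<in> borel_measurable P"
    and "\<And>\<xi>. \<xi> \<in> space P \<Longrightarrow> twice_differentiable (\<lambda>x. l x \<xi>)"
    and "\<And>\<xi> x x'. \<xi> \<in> space P \<Longrightarrow> \<bar>l x \<xi> - l x' \<xi>\<bar> \<le> G * norm (x - x')"
    and "\<And>\<xi> x x'. \<xi> \<in> space P \<Longrightarrow>
           norm (grad (\<lambda>x. l x \<xi>) x - grad (\<lambda>x. l x \<xi>) x') \<le> L * norm (x - x')"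
    and "\<And>\<xi> x x'. \<xi> \<in> space P \<Longrightarrow>
           norm (hess (\<lambda>x. l x \<xi>) x - hess (\<lambda>x. l x \<xi>) x') \<le> M * norm (x - x')"
    and "\<And>t. \<bar>conjugate \<psi> t\<bar> \<noteq> \<infinity>"
    and "strictly_convex_on UNIV (rconjugate \<psi>)"
    and "\<And>t. rconjugate \<psi> differentiable (at t)"
    and "\<And>t. deriv (rconjugate \<psi>) differentiable (at t)"
    and "continuous_on UNIV (deriv (deriv (rconjugate \<psi>)))"
    and "\<And>s s'. \<bar>deriv (rconjugate \<psi>) s - deriv (rconjugate \<psi>) s'\<bar> \<le> N\<^sub>1 * \<bar>s - s'\<bar>"
    and "\<And>s s'. \<bar>deriv (deriv (rconjugate \<psi>)) s - deriv (deriv (rconjugate \<psi>)) s'\<bar>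
           \<le> N\<^sub>2 * \<bar>s - s'\<bar>"
    and "\<And>x. (\<integral>\<xi>. (l x \<xi> - (\<integral>\<xi>'. l x \<xi>' \<partial>P))\<^sup>2 \<partial>P) \<le> \<sigma>\<^sup>2"
    and "\<And>x. AE \<xi> in P. m \<le> l x \<xi> \<and> l x \<xi> \<le> Mbar"
    and "\<delta>\<^sub>0 > 0"
    and "(INF t\<in>{t. deriv (rconjugate \<psi>) t \<ge> 1 - \<delta>\<^sub>0}. ereal t) > -\<infinity>"
    and "(SUP t\<in>{t. deriv (rconjugate \<psi>) t \<le> 1 + \<delta>\<^sub>0}. ereal t) < \<infinity>"
  defines "f \<equiv> dro_loss \<psi> lam l"
    and "F \<equiv> dro_objective \<psi> lam l P"
  shows "(\<forall>z. integrable P (\<lambda>\<xi>. f \<xi> z)) \<and>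
    (\<exists>L\<^sub>0 L\<^sub>1. L\<^sub>0 > 0 \<and> L\<^sub>1 \<ge> 0 \<and> gen_smooth F L\<^sub>0 L\<^sub>1) \<and>
    (\<exists>G\<^sub>0 G\<^sub>1. G\<^sub>0 \<ge> 0 \<and> G\<^sub>1 \<ge> 0 \<and> gen_grad_variance F f P G\<^sub>0 G\<^sub>1) \<and>
    twice_differentiable F \<and>
    (\<exists>\<delta> M\<^sub>0 M\<^sub>1. \<delta> > 0 \<and> M\<^sub>0 > 0 \<and> M\<^sub>1 \<ge> 0 \<and> gen_hess_smooth F \<delta> M\<^sub>0 M\<^sub>1) \<and>
    (\<exists>K\<^sub>0 K\<^sub>1. K\<^sub>0 \<ge> 0 \<and> K\<^sub>1 \<ge> 0 \<and> gen_hess_variance F f P K\<^sub>0 K\<^sub>1)"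
proof -
  define v where "v = (\<lambda>\<xi> z :: (real ^ 'n) \<times> real. l (fst z) \<xi> - snd z)"
  have diff: "(\<lambda>x. l x \<xi>) differentiable (at x)" if "\<xi> \<in> space P" for \<xi> x
    using assms(5)[OF that] unfolding twice_differentiable_def by blast
  \<comment> \<open>The given Lipschitz constants come without a sign, whereas the locale asks for
    nonnegative ones; this passes to absolute values.\<close>
  have le_abs: "k * t \<le> \<bar>k\<bar> * s" if "0 \<le> t" "t \<le> s" for k s t :: real
    using that by (intro mult_mono) auto
  have norm_fst_diff_le: "norm (fst z - fst y) \<le> norm (z - y)"
    and abs_snd_diff_le: "\<bar>snd z - snd y\<bar> \<le> norm (z - y)" for z y :: "(real ^ 'n) \<times> real"
    using norm_fst_le_norm[of "z - y"] norm_snd_le_norm[of "z - y"] by simp_all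
  interpret prob_space P
    by (rule assms(1))
  \<comment> \<open>In \<open>\<bar>G\<bar> + 1\<close> the two summands come from \<open>l\<close>
    and from \<open>- \<eta>\<close>. Subtracting \<open>\<eta>\<close> shifts the range of the loss
    but keeps its length \<open>Mbar - m\<close>, which therefore serves as \<open>R\<close> for
    every \<open>z\<close>.\<close>
  interpret composite_loss P v "rconjugate \<psi>" lam "\<bar>G\<bar> + 1" "\<bar>L\<bar>" "\<bar>M\<bar>" "\<bar>N\<^sub>1\<bar>" "\<bar>N\<^sub>2\<bar>"
    "Mbar - m" "(0, 1)"
  proof unfold_locales
    show "(\<lambda>\<xi>. v \<xi> z) \<in> borel_measurable P" for z
      unfolding v_def using assms(4) by measurable
    show "twice_differentiable (v \<xi>)" if "\<xi> \<in> space P" for \<xi>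
      unfolding v_def using assms(5)[OF that] by (rule twice_differentiable_minus_snd)
    show "\<bar>v \<xi> z - v \<xi> y\<bar> \<le> (\<bar>G\<bar> + 1) * norm (z - y)" if "\<xi> \<in> space P" for \<xi> z y
    proof -
      have "\<bar>l (fst z) \<xi> - l (fst y) \<xi>\<bar> \<le> \<bar>G\<bar> * norm (z - y)"
        using assms(6)[OF that] le_abs[OF norm_ge_zero norm_fst_diff_le] by (rule order_trans)
      then show ?thesis
        unfolding v_def distrib_right using abs_snd_diff_le[of z y] by linarith
    qed
    show "norm (grad (v \<xi>) z - grad (v \<xi>) y) \<le> \<bar>L\<bar> * norm (z - y)" if "\<xi> \<in> space P" for \<xi> z y
      using order_trans[OF assms(7)[OF that] le_abs[OF norm_ge_zero norm_fst_diff_le]]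
      unfolding v_def grad_minus_snd[OF diff[OF that]] by (simp add: norm_Pair)
    show "norm (hess (v \<xi>) z - hess (v \<xi>) y) \<le> \<bar>M\<bar> * norm (z - y)" if "\<xi> \<in> space P" for \<xi> z y
    proof (rule norm_blinfun_bound)
      fix a :: "(real ^ 'n) \<times> real"
      let ?H = "hess (\<lambda>x. l x \<xi>)"
      \<comment> \<open>The zero second component does not contribute to the norm, leaving only the
        Hessian of \<open>l\<close>.\<close>
      have "norm (blinfun_apply (hess (v \<xi>) z - hess (v \<xi>) y) a)
          = norm (blinfun_apply (?H (fst z) - ?H (fst y)) (fst a))"
        unfolding v_def
        by (simp add: blinfun.diff_left hess_minus_snd_apply[OF assms(5)[OF that]] norm_Pair)
      also have "\<dots> \<le> norm (?H (fst z) - ?H (fst y)) * norm (fst a)"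
        by (rule norm_blinfun)
      also have "\<dots> \<le> \<bar>M\<bar> * norm (z - y) * norm a"
        by (intro mult_mono order_trans[OF assms(8)[OF that] le_abs] norm_fst_diff_le norm_fst_le_norm) auto
      finally show "norm (blinfun_apply (hess (v \<xi>) z - hess (v \<xi>) y) a) \<le> \<bar>M\<bar> * norm (z - y) * norm a" .
    qed simp
    show "grad (v \<xi>) z \<bullet> (0, 1) = - 1" if "\<xi> \<in> space P" for \<xi> z
      unfolding v_def grad_minus_snd[OF diff[OF that]] by simp
    show "\<exists>a. AE \<xi> in P. a \<le> v \<xi> z \<and> v \<xi> z \<le> a + (Mbar - m)" for z
    proof
      show "AE \<xi> in P. m - snd z \<le> v \<xi> z \<and> v \<xi> z \<le> m - snd z + (Mbar - m)"
        using assms(17)[of "fst z"] by eventually_elim (simp add: v_def)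
    qed
    show "\<bar>deriv (rconjugate \<psi>) s - deriv (rconjugate \<psi>) t\<bar> \<le> \<bar>N\<^sub>1\<bar> * \<bar>s - t\<bar>" for s t
      using assms(14) le_abs[OF abs_ge_zero order_refl] by (rule order_trans)
    show "\<bar>deriv (deriv (rconjugate \<psi>)) s - deriv (deriv (rconjugate \<psi>)) t\<bar> \<le> \<bar>N\<^sub>2\<bar> * \<bar>s - t\<bar>" for s t
      using assms(15) le_abs[OF abs_ge_zero order_refl] by (rule order_trans)
  qed (use assms(2,11,12) in auto)
  have "f \<xi> z = loss \<xi> z" for \<xi> z
    unfolding loss_def f_def dro_loss_def by (cases z) (simp add: v_def)
  then have f_eq: "f = loss"
    by blast
  moreover have "F = objective"
    using f_eq by (simp add: f_def F_def dro_objective_def[abs_def] objective_def[abs_def])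
  ultimately show ?thesis
    using integrable_loss gen_smooth_objective gen_grad_variance_objective
      twice_differentiable_objective gen_hess_smooth_objective gen_hess_variance_objective
    by simp
qed

end
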